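(* Let $\alpha\ge0$, let $f\in\mathcal{W}^0_{\mathcal{H}}(\alpha)$, and let the positive integers $p$ and $q$ satisfy one of the following conditions: (i) $3\le p<q$; (ii) $p=q\ge2$; (iii) $p>q\ge3$; (iv) $p=3$ and $q=2$. Then $s_{p,q}(f)\in\mathcal{W}^0_{\mathcal{H}}(\alpha)$ in $|z|<1/2$.
   Context: $\mathbb{D}=\{z\in\mathbb{C}:|z|<1\}$. $\mathcal{H}$ is the class of complex-valued harmonic functions $f$ in $\mathbb{D}$ with $f(0)=0$ and $f_z(0)=1$; each has the canonical representation $f=h+\overline{g}$ with $h(z)=z+\sum_{n\ge2}a_nz^n$ and $g(z)=\sum_{n\ge1}b_nz^n$ analytic in $\mathbb{D}$. For $\alpha\ge0$, $\mathcal{W}^0_{\mathcal{H}}(\alpha)$ is the class of $f=h+\overline{g}\in\mathcal{H}$ with $g'(0)=0$ (so $b_1=0$) and $\mathrm{Re}(h'(z)+\alpha zh''(z))>|g'(z)+\alpha zg''(z)|$ for all $z\in\mathbb{D}$. For $p,q\ge1$ the $(p,q)$-th partial sum of $f=h+\overline{g}$ is $s_{p,q}(f)=s_p(h)+\overline{s_q(g)}$, where $s_p(h)(z)=\sum_{k=1}^pa_kz^k$ (with $a_1=1$) and $s_q(g)(z)=\sum_{k=1}^qb_kz^k$. The phrase "$s_{p,q}(f)\in\mathcal{W}^0_{\mathcal{H}}(\alpha)$ for (in) $|z|<r$" means that $\mathrm{Re}(s_p(h)'(z)+\alpha zs_p(h)''(z))>|s_q(g)'(z)+\alpha zs_q(g)''(z)|$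 for all $|z|<r$. *)

theory Defs
  imports "HOL-Complex_Analysis.Complex_Analysis"
begin

abbreviation unit_disc :: "complex set" where
  "unit_disc \<equiv> ball 0 1"

text \<open>
  Real partial derivatives of \<open>f\<close> with respect to \<open>x\<close> and \<open>y\<close>, where \<open>z = x + \<i> y\<close>.
\<close>

definition partial_x :: "(complex \<Rightarrow> complex) \<Rightarrow> complex \<Rightarrow> complex" where
  "partial_x f z = vector_derivative (\<lambda>t::real. f (z + of_real t)) (at 0)"

definition partial_y :: "(complex \<Rightarrow> complex) \<Rightarrow> complex \<Rightarrow> complex" where
  "partial_y f z = vector_derivative (\<lambda>t::real. f (z + \<i> * of_real t)) (at 0)"

definition C1_on :: "complex set \<Rightarrow> (complex \<Rightarrow> complex) \<Rightarrow> bool" where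
  "C1_on S f \<longleftrightarrow>
     (\<forall>z\<in>S. (\<lambda>t::real. f (z + of_real t)) differentiable at 0 \<and>
             (\<lambda>t::real. f (z + \<i> * of_real t)) differentiable at 0) \<and>
     continuous_on S (partial_x f) \<and> continuous_on S (partial_y f)"

definition harmonic_on :: "complex set \<Rightarrow> (complex \<Rightarrow> complex) \<Rightarrow> bool" where
  "harmonic_on S f \<longleftrightarrow>
     C1_on S f \<and> C1_on S (partial_x f) \<and> C1_on S (partial_y f) \<and>
     (\<forall>z\<in>S. partial_x (partial_x f) z + partial_y (partial_y f) z = 0)"

text \<open>The Wirtinger derivative \<open>f\<^sub>z\<close>.\<close>

definition wirtinger_z :: "(complex \<Rightarrow> complex) \<Rightarrow> complex \<Rightarrow> complex" where
  "wirtinger_z f z = (partial_x f z - \<i> * partial_y f z) / 2"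

text \<open>
  The class \<open>\<H>\<close>. Here and below, functions on the unit disc are total functions on the
  complex numbers whose values outside the disc are irrelevant.
\<close>

definition harmonic_class :: "(complex \<Rightarrow> complex) set" where
  "harmonic_class = {f. harmonic_on unit_disc f \<and> f 0 = 0 \<and> wirtinger_z f 0 = 1}"

text \<open>
  The canonical representation \<open>f = h + cnj g\<close> with \<open>h(z) = z + \<Sum>\<^sub>n\<^sub>\<ge>\<^sub>2 a\<^sub>n z\<^sup>n\<close> and
  \<open>g(z) = \<Sum>\<^sub>n\<^sub>\<ge>\<^sub>1 b\<^sub>n z\<^sup>n\<close>. It determines \<open>h\<close> and \<open>g\<close> on the unit disc.
\<close>

definition canonical_rep ::
    "(complex \<Rightarrow> complex) \<Rightarrow> (complex \<Rightarrow> complex) \<Rightarrow> (complex \<Rightarrow> complex) \<Rightarrow> bool" where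
  "canonical_rep f h g \<longleftrightarrow>
     h holomorphic_on unit_disc \<and> g holomorphic_on unit_disc \<and>
     h 0 = 0 \<and> deriv h 0 = 1 \<and> g 0 = 0 \<and>
     (\<forall>z\<in>unit_disc. f z = h z + cnj (g z))"

definition WH_condition ::
    "real \<Rightarrow> complex set \<Rightarrow> (complex \<Rightarrow> complex) \<Rightarrow> (complex \<Rightarrow> complex) \<Rightarrow> bool" where
  "WH_condition \<alpha> S h g \<longleftrightarrow>
     (\<forall>z\<in>S. Re (deriv h z + of_real \<alpha> * z * deriv (deriv h) z)
              > cmod (deriv g z + of_real \<alpha> * z * deriv (deriv g) z))"

text \<open>The class \<open>\<W>\<^sup>0\<^sub>\<H>(\<alpha>)\<close>.\<close>

definition WH0 :: "real \<Rightarrow> (complex \<Rightarrow> complex) set" where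
  "WH0 \<alpha> = {f \<in> harmonic_class.
     \<exists>h g. canonical_rep f h g \<and> deriv g 0 = 0 \<and> WH_condition \<alpha> unit_disc h g}"

text \<open>
  \<open>partial_sum p h\<close> is the Taylor section \<open>s\<^sub>p(h)\<close> at the origin, without constant term. The harmonic
  partial sum \<open>s\<^sub>p\<^sub>,\<^sub>q(f) = s\<^sub>p(h) + cnj (s\<^sub>q(g))\<close> is said to belong to \<open>\<W>\<^sup>0\<^sub>\<H>(\<alpha>)\<close> in the disc
  of radius \<open>r\<close> around \<open>0\<close> if \<open>s\<^sub>p(h)\<close> and \<open>s\<^sub>q(g)\<close> satisfy the defining inequality there.
\<close>

definition partial_sum :: "nat \<Rightarrow> (complex \<Rightarrow> complex) \<Rightarrow> complex \<Rightarrow> complex" where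
  "partial_sum p h z = (\<Sum>k=1..p. (deriv ^^ k) h 0 / fact k * z ^ k)"

definition partial_sum_in_WH0 ::
    "real \<Rightarrow> nat \<Rightarrow> nat \<Rightarrow> (complex \<Rightarrow> complex) \<Rightarrow> (complex \<Rightarrow> complex) \<Rightarrow> real \<Rightarrow> bool" where
  "partial_sum_in_WH0 \<alpha> p q h g r \<longleftrightarrow>
     WH_condition \<alpha> (ball 0 r) (partial_sum p h) (partial_sum q g)"

end

theory Submission
  imports Defs
begin

text \<open>
  Write \<open>P = h' + \<alpha> z h''\<close> and \<open>Q = g' + \<alpha> z g''\<close>. The hypothesis says that
  \<open>F = P + e Q\<close> has positive real part for every \<open>e\<close> with \<open>|e| \<le> 1\<close>, and \<open>F(0) = 1\<close>.
  Sections of such an \<open>F\<close> are averages over circles of \<open>Re F\<close> against the kernel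
  \<open>1 + 2 Re (w + \<dots> + w\<^sup>n)\<close>, which for \<open>|w| < 1/2\<close> is positive if \<open>n = 1\<close> and at least \<open>1/4\<close> if
  \<open>n \<ge> 2\<close>. So for \<open>n \<ge> 2\<close> the \<open>n\<close>-th sections satisfy \<open>Re s\<^sub>n(P) \<ge> |s\<^sub>n(Q)| + 1/4\<close>.
  The Taylor coefficients of \<open>Q\<close> have modulus at most \<open>1\<close>, so replacing \<open>s\<^sub>n(Q)\<close> by a section
  \<open>s\<^sub>m(Q)\<close> costs less than \<open>1/4\<close>, both if \<open>m, n \<ge> 2\<close> and if \<open>n = 2\<close>, \<open>m = 1\<close>.
  Here \<open>n = p - 1\<close> and \<open>m = q - 1\<close>.
\<close>

section \<open>Fourier coefficients on circles and positive real part\<close>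

text \<open>Cauchy's formula for the \<open>k\<close>-th derivative, written out on
  \<open>circlepath 0 r\<close> and multiplied by \<open>r ^ k / \<i>\<close>.\<close>

lemma cis_moment:
  fixes F :: "complex \<Rightarrow> complex"
  assumes F: "F holomorphic_on unit_disc" and r: "0 < r" "r < 1"
  shows "((\<lambda>t. F (of_real r * cis t) * cis (- (real k * t))) has_integral
           2 * pi * ((deriv ^^ k) F 0 / fact k * of_real r ^ k)) {0..2*pi}"
proof -
  have sub: "cball 0 r \<subseteq> unit_disc"
    using r by auto
  have "((\<lambda>u. F u / (u - 0) ^ Suc k) has_contour_integral
          (2 * pi * \<i>) / fact k * (deriv ^^ k) F 0) (circlepath 0 r)"
  proof (rule Cauchy_has_contour_integral_higher_derivative_circlepath)
    show "continuous_on (cball 0 r) F"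
      using F sub holomorphic_on_imp_continuous_on continuous_on_subset by blast
    show "F holomorphic_on ball 0 r"
      using F by (rule holomorphic_on_subset) (use r in auto)
  qed (use r in auto)
  then have "((\<lambda>t. F (0 + r * cis t) / (0 + r * cis t - 0) ^ Suc k * r * \<i> * cis t) has_integral
          (2 * pi * \<i>) / fact k * (deriv ^^ k) F 0) {0..2*pi}"
    unfolding circlepath_def by (subst (asm) has_contour_integral_part_circlepath_iff) auto
  from has_integral_mult_right[OF this, of "of_real r ^ k / \<i>"]
  have "((\<lambda>t. of_real r ^ k / \<i> * (F (r * cis t) / (r * cis t) ^ Suc k * r * \<i> * cis t)) has_integral
          of_real r ^ k / \<i> * ((2 * pi * \<i>) / fact k * (deriv ^^ k) F 0)) {0..2*pi}"
    by simp
  moreover have "of_real r ^ k / \<i> * (F (r * cis t) / (r * cis t) ^ Suc k * r * \<i> * cis t)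
      = F (of_real r * cis t) * cis (- (real k * t))" for t
    using r by (simp add: field_simps power_mult_distrib Complex.DeMoivre cis_mult)
  moreover have "of_real r ^ k / \<i> * ((2 * pi * \<i>) / fact k * (deriv ^^ k) F 0)
      = 2 * pi * ((deriv ^^ k) F 0 / fact k * of_real r ^ k)"
    by (simp add: field_simps)
  ultimately show ?thesis
    by simp
qed

text \<open>The integral is, up to the factor \<open>r ^ k\<close>, the moment of order 0 of
  \<open>z ^ k * F z\<close>, a function that vanishes at 0 because \<open>k > 0\<close>.\<close>

lemma cis_moment_negative:
  fixes F :: "complex \<Rightarrow> complex"
  assumes F: "F holomorphic_on unit_disc" and r: "0 < r" "r < 1" and k: "k > 0"
  shows "((\<lambda>t. F (of_real r * cis t) * cis (real k * t)) has_integral 0) {0..2*pi}"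
proof -
  have "((\<lambda>t. (of_real r * cis t) ^ k * F (of_real r * cis t) * cis (- (real 0 * t))) has_integral
           2 * pi * ((deriv ^^ 0) (\<lambda>z. z ^ k * F z) 0 / fact 0 * of_real r ^ 0)) {0..2*pi}"
    by (rule cis_moment) (use F r in \<open>auto intro!: holomorphic_intros\<close>)
  from has_integral_mult_right[OF this, of "inverse (of_real r ^ k)"]
  have "((\<lambda>t. inverse (of_real r ^ k) * ((of_real r * cis t) ^ k * F (of_real r * cis t)))
          has_integral 0) {0..2*pi}"
    using k by (simp add: zero_power)
  moreover have "inverse (of_real r ^ k) * ((of_real r * cis t) ^ k * F (of_real r * cis t))
     = F (of_real r * cis t) * cis (real k * t)" for t
    using r by (simp add: power_mult_distrib Complex.DeMoivre)
  ultimately show ?thesis by simp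
qed

text \<open>Integrating \<open>F\<close> against \<open>w t ^ k\<close> extracts the
  \<open>k\<close>-th Taylor term at \<open>z\<close>. The conjugate powers integrate to 0, so
  adding them is free and turns the kernel into the real function \<open>K\<close>. The section is
  then an average of \<open>F\<close> weighted by \<open>K \<ge> \<delta>\<close>, and
  \<open>Re F\<close> has mean \<open>Re (F 0) = 1\<close>.\<close>

lemma Re_taylor_section_ge:
  assumes F: "F holomorphic_on unit_disc" and F0: "F 0 = 1"
    and pos: "\<And>u. u \<in> unit_disc \<Longrightarrow> Re (F u) \<ge> 0"
    and r: "0 < r" "r < 1"
    and ker: "\<And>w. cmod w = cmod z / r \<Longrightarrow> 1 + 2 * (\<Sum>k=1..n. Re (w ^ k)) \<ge> \<delta>"
  shows "Re (\<Sum>k\<le>n. (deriv ^^ k) F 0 / fact k * z ^ k) \<ge> \<delta>"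
proof -
  define w where "w t = z / of_real r * cis (- t)" for t
  define c where "c k = (deriv ^^ k) F 0 / fact k" for k
  have c0: "c 0 = 1"
    by (simp add: c_def F0)
  have wk: "w t ^ k = (z / of_real r) ^ k * cis (- (real k * t))" for t k
    unfolding w_def power_mult_distrib by (simp add: Complex.DeMoivre)
  have A: "((\<lambda>t. F (of_real r * cis t) * w t ^ k) has_integral 2 * pi * (c k * z ^ k)) {0..2*pi}" for k
    using has_integral_mult_right[OF cis_moment[OF F r, of k], of "(z / of_real r) ^ k"] r
    by (simp add: wk c_def power_divide mult_ac)
  have B: "((\<lambda>t. F (of_real r * cis t) * cnj (w t ^ k)) has_integral 0) {0..2*pi}" if "k > 0" for k
    using has_integral_mult_right[OF cis_moment_negative[OF F r that], of "cnj ((z / of_real r) ^ k)"] r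
    by (simp add: wk cis_cnj mult_ac)
  have I: "((\<lambda>t. F (of_real r * cis t) * w t ^ 0
            + (\<Sum>k=1..n. F (of_real r * cis t) * w t ^ k + F (of_real r * cis t) * cnj (w t ^ k)))
        has_integral (2 * pi * (c 0 * z ^ 0) + (\<Sum>k=1..n. 2 * pi * (c k * z ^ k) + 0))) {0..2*pi}"
    by (intro has_integral_add has_integral_sum A B) auto
  define K where "K t = 1 + 2 * (\<Sum>k=1..n. Re (w t ^ k))" for t
  have eq: "F (of_real r * cis t) * w t ^ 0
            + (\<Sum>k=1..n. F (of_real r * cis t) * w t ^ k + F (of_real r * cis t) * cnj (w t ^ k))
        = F (of_real r * cis t) * of_real (K t)" for t
  proof -
    have "(\<Sum>k=1..n. F (of_real r * cis t) * w t ^ k + F (of_real r * cis t) * cnj (w t ^ k))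
       = (\<Sum>k=1..n. F (of_real r * cis t) * (2 * of_real (Re (w t ^ k))))"
      by (intro sum.cong refl)
         (simp add: complex_add_cnj flip: distrib_left del: complex_cnj_power)
    then show ?thesis
      by (simp add: K_def sum_distrib_left algebra_simps)
  qed
  have sum_eq: "2 * pi * (c 0 * z ^ 0) + (\<Sum>k=1..n. 2 * pi * (c k * z ^ k) + 0)
      = 2 * pi * (\<Sum>k\<le>n. c k * z ^ k)"
    by (simp add: sum_distrib_left atMost_atLeast0 sum.atLeast_Suc_atMost algebra_simps)
  have J: "((\<lambda>t. Re (F (of_real r * cis t)) * K t) has_integral
        2 * pi * Re (\<Sum>k\<le>n. c k * z ^ k)) {0..2*pi}"
    using has_integral_Re[OF I[unfolded eq sum_eq]] by simp
  have "((\<lambda>t. Re (F (of_real r * cis t) * w t ^ 0)) has_integral Re (2 * pi * (c 0 * z ^ 0))) {0..2*pi}"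
    by (rule has_integral_Re[OF A])
  then have "((\<lambda>t. Re (F (of_real r * cis t))) has_integral 2 * pi) {0..2*pi}"
    by (simp add: c0)
  then have L: "((\<lambda>t. Re (F (of_real r * cis t)) * \<delta>) has_integral 2 * pi * \<delta>) {0..2*pi}"
    by (rule has_integral_mult_left)
  have "2 * pi * \<delta> \<le> 2 * pi * Re (\<Sum>k\<le>n. c k * z ^ k)"
  proof (rule has_integral_le[OF L J])
    fix t
    have "cmod (w t) = cmod z / r"
      using r by (simp add: w_def norm_mult norm_divide)
    then have "K t \<ge> \<delta>"
      using ker by (simp add: K_def)
    moreover have "Re (F (of_real r * cis t)) \<ge> 0"
      using r by (intro pos) (simp add: norm_mult)
    ultimately show "Re (F (of_real r * cis t)) * \<delta> \<le> Re (F (of_real r * cis t)) * K t"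
      by (rule mult_left_mono)
  qed
  then show ?thesis
    by (simp add: c_def)
qed

text \<open>On each circle \<open>|Q|\<close> is dominated by \<open>Re P\<close>, whose mean is
  \<open>Re (P 0) = 1\<close>. This bounds the coefficient by \<open>1 / r ^ k\<close>, and
  \<open>r\<close> tends to 1.\<close>

lemma taylor_coeff_norm_le_1:
  fixes P Q :: "complex \<Rightarrow> complex"
  assumes P: "P holomorphic_on unit_disc" and P0: "P 0 = 1" and Q: "Q holomorphic_on unit_disc"
    and le: "\<And>u. u \<in> unit_disc \<Longrightarrow> cmod (Q u) \<le> Re (P u)"
  shows "cmod ((deriv ^^ k) Q 0 / fact k) \<le> 1"
proof -
  define c where "c = cmod ((deriv ^^ k) Q 0 / fact k)"
  have *: "c * r ^ k \<le> 1" if r: "0 < r" "r < 1" for r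
  proof -
    have IP: "((\<lambda>t. Re (P (of_real r * cis t))) has_integral 2 * pi) {0..2*pi}"
      using has_integral_Re[OF cis_moment[OF P r, of 0]] by (simp add: P0)
    note IQ = cis_moment[OF Q r, of k]
    have "norm (integral {0..2*pi} (\<lambda>t. Q (of_real r * cis t) * cis (- (real k * t))))
        \<le> integral {0..2*pi} (\<lambda>t. Re (P (of_real r * cis t)))"
    proof (rule integral_norm_bound_integral)
      show "norm (Q (of_real r * cis t) * cis (- (real k * t))) \<le> Re (P (of_real r * cis t))" for t
        using le[of "of_real r * cis t"] r by (simp add: norm_mult)
    qed (use IP IQ in \<open>auto simp: has_integral_integrable\<close>)
    then have "2 * pi * (c * r ^ k) \<le> 2 * pi"
      unfolding integral_unique[OF IP] integral_unique[OF IQ] c_def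
      using r by (simp add: norm_mult norm_power norm_divide)
    then show ?thesis by simp
  qed
  have "((\<lambda>r. c * r ^ k) \<longlongrightarrow> c * 1 ^ k) (at_left 1)"
    by (intro tendsto_intros)
  moreover have "eventually (\<lambda>r. c * r ^ k \<le> 1) (at_left (1::real))"
    using eventually_at_left_real[of 0 "1::real"] by (auto elim!: eventually_mono intro!: *)
  ultimately have "c * 1 ^ k \<le> 1"
    by (intro tendsto_upperbound) auto
  then show ?thesis
    by (simp add: c_def)
qed

lemma taylor_section_pair_ge:
  fixes P Q :: "complex \<Rightarrow> complex"
  assumes P: "P holomorphic_on unit_disc" and P0: "P 0 = 1"
    and Q: "Q holomorphic_on unit_disc" and Q0: "Q 0 = 0"
    and le: "\<And>u. u \<in> unit_disc \<Longrightarrow> cmod (Q u) \<le> Re (P u)"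
    and r: "0 < r" "r < 1"
    and ker: "\<And>w. cmod w = cmod z / r \<Longrightarrow> 1 + 2 * (\<Sum>k=1..n. Re (w ^ k)) \<ge> \<delta>"
  shows "cmod (\<Sum>k\<le>n. (deriv ^^ k) Q 0 / fact k * z ^ k) + \<delta>
         \<le> Re (\<Sum>k\<le>n. (deriv ^^ k) P 0 / fact k * z ^ k)"
proof -
  define S where "S = (\<Sum>k\<le>n. (deriv ^^ k) Q 0 / fact k * z ^ k)"
  \<comment> \<open>Rotates the section of \<open>Q\<close> at the fixed point \<open>z\<close> onto
    the negative real axis. If \<open>S = 0\<close>, then \<open>sgn S = 0\<close> and
    \<open>e = 0\<close>, which is still admissible.\<close>
  define e where "e = - cnj (sgn S)"
  have e: "cmod e \<le> 1"
    by (simp add: e_def norm_sgn)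
  have eS: "e * S = - of_real (cmod S)"
    using complex_norm_square[of S]
    by (cases "S = 0")
       (auto simp: e_def sgn_div_norm scaleR_conv_of_real field_simps power2_eq_square)
  define F where "F u = P u + e * Q u" for u
  have "\<delta> \<le> Re (\<Sum>k\<le>n. (deriv ^^ k) F 0 / fact k * z ^ k)"
  proof (rule Re_taylor_section_ge)
    show "F holomorphic_on unit_disc"
      unfolding F_def by (intro holomorphic_intros P Q)
    show "Re (F u) \<ge> 0" if "u \<in> unit_disc" for u
    proof -
      have "cmod (e * Q u) \<le> 1 * cmod (Q u)"
        unfolding norm_mult using e by (intro mult_right_mono) auto
      then show ?thesis
        using le[OF that] abs_Re_le_cmod[of "e * Q u"] unfolding F_def plus_complex.sel by linarith
    qed
  qed (use r ker in \<open>auto simp: F_def P0 Q0\<close>)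
  also have "(deriv ^^ k) F 0 = (deriv ^^ k) P 0 + e * (deriv ^^ k) Q 0" for k
    unfolding F_def
    by (subst higher_deriv_add[OF P _ open_ball])
       (auto intro!: holomorphic_intros Q simp: higher_deriv_cmult[OF Q])
  then have "(\<Sum>k\<le>n. (deriv ^^ k) F 0 / fact k * z ^ k)
      = (\<Sum>k\<le>n. (deriv ^^ k) P 0 / fact k * z ^ k) + e * S"
    by (simp add: S_def add_divide_distrib ring_distribs sum.distrib sum_distrib_left mult.assoc)
  finally show ?thesis
    unfolding eS S_def[symmetric] by simp
qed

section \<open>Numerical estimates for the kernel and for geometric tails\<close>

text \<open>For \<open>n = 2\<close> completing the square suffices, with equality possible at
  \<open>Re w = -1/4\<close>, \<open>|w| = 1/2\<close>. This case stands apart because there the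
  error bound for the closed form of the geometric sum would be \<open>a / 4\<close>, too large for
  \<open>a\<close> near 3/2.\<close>

lemma Re_geometric_kernel_ge_quarter:
  assumes w: "cmod w \<le> 1 / 2" and n: "n \<ge> 2"
  shows "1 + 2 * (\<Sum>k=1..n. Re (w ^ k)) \<ge> 1 / 4"
proof -
  have w2: "(cmod w)\<^sup>2 \<le> (1/2)\<^sup>2"
    using w by (intro power_mono) auto
  show ?thesis
  proof (cases "n = 2")
    case True
    have "{1..n} = {1, 2}"
      using True by auto
    then have "1 + 2 * (\<Sum>k=1..n. Re (w ^ k)) = (2 * Re w + 1 / 2)\<^sup>2 + 3 / 4 - 2 * (cmod w)\<^sup>2"
      using cmod_power2[of w] by (simp add: power2_eq_square algebra_simps)
    moreover have "(2 * Re w + 1 / 2)\<^sup>2 \<ge> 0"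
      by simp
    moreover have "(1 / 2 :: real)\<^sup>2 = 1 / 4"
      by (simp add: power2_eq_square)
    ultimately show ?thesis
      using w2 by linarith
  next
    case False
    with n have n: "n \<ge> 3" by simp
    \<comment> \<open>\<open>(1 - w) K = 1 + w - 2 w\<^sup>n\<^sup>+\<^sup>1\<close>, so \<open>a\<^sup>2 Re K = 1 - |w|\<^sup>2\<close> up to an error of at most \<open>a / 8\<close>\<close>
    define a where "a = cmod (1 - w)"
    define K where "K = 1 + 2 * (\<Sum>k=1..n. w ^ k)"
    have a: "a \<le> 3 / 2" "a \<ge> 1 / 2"
      using w norm_triangle_ineq4[of 1 w] norm_triangle_ineq2[of 1 w] by (auto simp: a_def)
    have "(1 - w) * (\<Sum>k=1..n. w ^ k) = w - w ^ Suc n"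
      using sum_gp_multiplied[of 1 n w] n by simp
    moreover have "(1 - w) * K = (1 - w) + 2 * ((1 - w) * (\<Sum>k=1..n. w ^ k))"
      unfolding K_def by (simp add: algebra_simps)
    ultimately have "(1 - w) * K = 1 + w - 2 * w ^ Suc n"
      by simp
    then have "cnj (1 - w) * (1 - w) * K = cnj (1 - w) * (1 + w) - cnj (1 - w) * (2 * w ^ Suc n)"
      by (metis mult.assoc right_diff_distrib)
    moreover have "cnj (1 - w) * (1 - w) = of_real (a\<^sup>2)"
      using complex_norm_square[of "1 - w"] by (simp add: a_def mult.commute)
    ultimately have "of_real (a\<^sup>2) * K = cnj (1 - w) * (1 + w) - cnj (1 - w) * (2 * w ^ Suc n)"
      by (simp only:)
    then have "Re (of_real (a\<^sup>2) * K) = Re (cnj (1 - w) * (1 + w) - cnj (1 - w) * (2 * w ^ Suc n))"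
      by (rule arg_cong)
    then have "a\<^sup>2 * Re K = Re (cnj (1 - w) * (1 + w)) - Re (cnj (1 - w) * (2 * w ^ Suc n))"
      by (simp only: minus_complex.sel times_complex.sel(1)[of "of_real (a\<^sup>2)"] Re_complex_of_real Im_complex_of_real mult_zero_left diff_zero)
    moreover have "Re (cnj (1 - w) * (1 + w)) = 1 - (cmod w)\<^sup>2"
      using cmod_power2[of w] by (simp add: algebra_simps power2_eq_square)
    moreover have "Re (cnj (1 - w) * (2 * w ^ Suc n)) \<le> a / 8"
    proof -
      have "cmod w ^ Suc n \<le> (1 / 2) ^ Suc n"
        using w by (intro power_mono) auto
      also have "\<dots> \<le> (1 / 2) ^ 4"
        using n by (intro power_decreasing) auto
      finally have "a * (2 * cmod w ^ Suc n) \<le> a * (2 * (1 / 2) ^ 4)"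
        using a by (intro mult_left_mono) auto
      moreover have "cmod (cnj (1 - w) * (2 * w ^ Suc n)) = a * (2 * cmod w ^ Suc n)"
        unfolding norm_mult complex_mod_cnj norm_power by (simp add: a_def)
      ultimately show ?thesis
        using complex_Re_le_cmod[of "cnj (1 - w) * (2 * w ^ Suc n)"]
        by (simp add: power_numeral_reduce)
    qed
    ultimately have "a\<^sup>2 * Re K \<ge> 3 / 4 - a / 8"
      using w2 by (simp add: power2_eq_square)
    \<comment> \<open>The product is 8 times \<open>3 / 4 - a / 8 - a\<^sup>2 / 4\<close>, so the
      bound \<open>a \<le> 3 / 2\<close> is exactly what is needed.\<close>
    moreover have "0 \<le> (3 - 2 * a) * (a + 2)"
      using a by (intro mult_nonneg_nonneg) auto
    then have "3 / 4 - a / 8 \<ge> a\<^sup>2 * (1 / 4)"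
      by (simp add: power2_eq_square algebra_simps)
    ultimately have "a\<^sup>2 * (1 / 4) \<le> a\<^sup>2 * Re K"
      by linarith
    then have "Re K \<ge> 1 / 4"
      using a by simp
    then show ?thesis
      by (simp add: K_def)
  qed
qed

text \<open>The full series from exponent 3 on sums to 1/4, and a finite part of it stays strictly
  below.\<close>

lemma sum_half_powers_less:
  fixes A :: "nat set"
  assumes "finite A" and "A \<subseteq> {3..}"
  shows "(\<Sum>k\<in>A. (1 / 2 :: real) ^ k) < 1 / 4"
proof -
  have *: "(\<Sum>k=3..N+2. (1 / 2 :: real) ^ k) \<le> 1 / 4 - (1 / 2) ^ (N + 2)" for N
    by (induction N) (simp_all add: power2_eq_square)
  \<comment> \<open>Inserting 0 keeps \<open>Max\<close> meaningful for empty
    \<open>A\<close>.\<close>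
  define N where "N = Max (insert 0 A)"
  have "A \<subseteq> {3..N+2}"
    using assms by (force simp: N_def intro: le_SucI)
  then have "(\<Sum>k\<in>A. (1 / 2 :: real) ^ k) \<le> (\<Sum>k=3..N+2. (1 / 2) ^ k)"
    by (intro sum_mono2) auto
  also note *
  finally show ?thesis
    using zero_less_power[of "1 / 2 :: real" "N + 2"] by linarith
qed

lemma norm_diff_sums_le:
  fixes x :: "nat \<Rightarrow> 'a::real_normed_vector"
  shows "norm ((\<Sum>k\<le>m. x k) - (\<Sum>k\<le>n. x k)) \<le> (\<Sum>k\<in>{min m n<..max m n}. norm (x k))"
proof (induction m n rule: linorder_wlog)
  case (le m n)
  then have "{..n} = {..m} \<union> {m<..n}"
    by auto
  then have "(\<Sum>k\<le>n. x k) = (\<Sum>k\<le>m. x k) + (\<Sum>k\<in>{m<..n}. x k)"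
    by (metis finite_atMost finite_greaterThanAtMost ivl_disj_int_one(3) sum.union_disjoint)
  then show ?case
    using le norm_sum[of x "{m<..n}"] by simp
next
  case (sym m n)
  then show ?case
    by (simp add: norm_minus_commute min.commute max.commute)
qed

section \<open>Comparison of sections of different lengths\<close>

lemma norm_section_less_Re_section:
  fixes P Q :: "complex \<Rightarrow> complex"
  assumes P: "P holomorphic_on unit_disc" and P0: "P 0 = 1"
    and Q: "Q holomorphic_on unit_disc" and Q0: "Q 0 = 0"
    and le: "\<And>u. u \<in> unit_disc \<Longrightarrow> cmod (Q u) \<le> Re (P u)"
    and z: "cmod z < 1 / 2"
    and nm: "n = 1 \<and> m = 1 \<or> n \<ge> 2 \<and> m \<ge> 2 \<or> n = 2 \<and> m = 1"
  shows "cmod (\<Sum>k\<le>m. (deriv ^^ k) Q 0 / fact k * z ^ k)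
       < Re (\<Sum>k\<le>n. (deriv ^^ k) P 0 / fact k * z ^ k)"
proof -
  \<comment> \<open>The circle of radius \<open>r\<close> lies inside the disc, yet \<open>z\<close>
    still has relative modulus \<open>|z| / r\<close> below 1/2.\<close>
  obtain r where r: "2 * cmod z < r" "r < 1"
    using z dense[of "2 * cmod z" 1] by auto
  then have r0: "r > 0"
    using norm_ge_zero[of z] by linarith
  have zr: "cmod z / r < 1 / 2"
    using r r0 by (simp add: field_simps)
  note pair = taylor_section_pair_ge[OF P P0 Q Q0 le r0 r(2), where z = z and n = n]
  show ?thesis
  proof (cases "n = 1")
    case True
    \<comment> \<open>For \<open>n = 1\<close> the margin is positive but can be arbitrarily small;
      it suffices since here \<open>m = n\<close>.\<close>
    have "1 + 2 * (\<Sum>k=1..n. Re (w ^ k)) \<ge> 1 - 2 * (cmod z / r)" if "cmod w = cmod z / r" for w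
      using True that abs_Re_le_cmod[of w] by simp
    from pair[OF _ this] True nm zr show ?thesis
      by simp
  next
    case False
    define x where "x k = (deriv ^^ k) Q 0 / fact k * z ^ k" for k
    have x: "norm (x k) \<le> cmod z ^ k" for k
      using mult_right_mono[OF taylor_coeff_norm_le_1[OF P P0 Q le, of k], of "cmod z ^ k"]
      by (simp add: x_def norm_mult norm_power norm_divide)
    have "norm ((\<Sum>k\<le>m. x k) - (\<Sum>k\<le>n. x k)) \<le> (\<Sum>k\<in>{min m n<..max m n}. norm (x k))"
      by (rule norm_diff_sums_le)
    also have "\<dots> \<le> (\<Sum>k\<in>{min m n<..max m n}. cmod z ^ k)"
      by (intro sum_mono x)
    also have "\<dots> < 1 / 4"
    proof (cases "m = 1")
      case True
      \<comment> \<open>Only the quadratic term separates the two sections, and it costs at most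
        \<open>|z|\<^sup>2 < 1/4\<close>.\<close>
      with nm False have "{min m n<..max m n} = {2}"
        by auto
      then show ?thesis
        using power_strict_mono[OF z, of 2] by (simp add: power2_eq_square)
    next
      case m: False
      have "(\<Sum>k\<in>{min m n<..max m n}. cmod z ^ k) \<le> (\<Sum>k\<in>{min m n<..max m n}. (1 / 2) ^ k)"
        using z by (intro sum_mono power_mono) auto
      also have "\<dots> < 1 / 4"
        by (rule sum_half_powers_less) (use nm m False in auto)
      finally show ?thesis .
    qed
    finally have "norm (\<Sum>k\<le>m. x k) < norm (\<Sum>k\<le>n. x k) + 1 / 4"
      using norm_triangle_ineq2[of "\<Sum>k\<le>m. x k" "\<Sum>k\<le>n. x k"] by linarith
    also have "1 + 2 * (\<Sum>k=1..n. Re (w ^ k)) \<ge> 1 / 4" if "cmod w = cmod z / r" for w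
      by (rule Re_geometric_kernel_ge_quarter) (use that zr nm False in auto)
    then have "norm (\<Sum>k\<le>n. x k) + 1 / 4 \<le> Re (\<Sum>k\<le>n. (deriv ^^ k) P 0 / fact k * z ^ k)"
      unfolding x_def by (intro pair)
    finally show ?thesis
      by (simp add: x_def)
  qed
qed

section \<open>Uniqueness of the canonical representation\<close>

text \<open>By the open mapping theorem a nonconstant image would be open, and so contain a point
  just above a real one.\<close>

lemma holomorphic_real_valued_imp_constant:
  assumes "f holomorphic_on S" and "open S" and "connected S" and "\<And>z. z \<in> S \<Longrightarrow> f z \<in> \<real>"
  shows "f constant_on S"
proof (rule ccontr)
  assume nc: "\<not> f constant_on S"
  then obtain z where z: "z \<in> S"
    by (auto simp: constant_on_def)
  have "open (f ` S)"
    using assms nc by (intro open_mapping_thm[of f S]) auto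
  then obtain e where e: "e > 0" "ball (f z) e \<subseteq> f ` S"
    using z by (meson imageI open_contains_ball)
  have "f z + \<i> * of_real (e / 2) \<in> ball (f z) e"
    using e by (simp add: dist_norm norm_mult)
  then have "f z + \<i> * of_real (e / 2) \<in> \<real>"
    using e assms(4) by auto
  then show False
    using e assms(4)[OF z] by (simp add: complex_is_Real_iff)
qed

lemma canonical_rep_unique:
  assumes "canonical_rep f h g" and "canonical_rep f h' g'" and z: "z \<in> unit_disc"
  shows "h z = h' z" and "g z = g' z"
proof -
  define k where "k z = h z - h' z" for z
  define m where "m z = g' z - g z" for z
  \<comment> \<open>\<open>k = cnj m\<close> makes the holomorphic function \<open>k m\<close> real-valued, hence constant\<close>
  have km: "k u = cnj (m u)" if "u \<in> unit_disc" for u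
    using assms that by (auto simp: canonical_rep_def k_def m_def algebra_simps)
  have "(\<lambda>z. k z * m z) constant_on unit_disc"
  proof (rule holomorphic_real_valued_imp_constant)
    show "(\<lambda>z. k z * m z) holomorphic_on unit_disc"
      using assms unfolding k_def m_def canonical_rep_def by (auto intro!: holomorphic_intros)
    show "k u * m u \<in> \<real>" if "u \<in> unit_disc" for u
      using km[OF that] by (simp add: complex_is_Real_iff)
  qed auto
  then obtain c where c: "\<And>u. u \<in> unit_disc \<Longrightarrow> k u * m u = c"
    by (auto simp: constant_on_def)
  have "k 0 * m 0 = 0"
    using assms by (simp add: k_def m_def canonical_rep_def)
  then have "k z * m z = 0"
    using c[of 0] c[OF z] by simp
  \<comment> \<open>As \<open>k z = cnj (m z)\<close>, one factor vanishes only together with the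
    other.\<close>
  then have "k z = 0 \<and> m z = 0"
    using km[OF z] by auto
  then show "h z = h' z" and "g z = g' z"
    by (auto simp: k_def m_def)
qed

section \<open>The differential operator of the class and its action on Taylor sections\<close>

text \<open>Sends each monomial \<open>z ^ k\<close> with \<open>k \<ge> 1\<close> to a multiple of
  \<open>z ^ (k - 1)\<close>, and so commutes with truncation up to an index shift.\<close>

definition WH_op :: "real \<Rightarrow> (complex \<Rightarrow> complex) \<Rightarrow> complex \<Rightarrow> complex" where
  "WH_op \<alpha> h z = deriv h z + of_real \<alpha> * z * deriv (deriv h) z"

lemma holomorphic_WH_op:
  assumes "h holomorphic_on S" and "open S"
  shows "WH_op \<alpha> h holomorphic_on S"
  unfolding WH_op_def by (intro holomorphic_intros holomorphic_deriv assms)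

text \<open>In the Leibniz formula for \<open>z * deriv (deriv h) z\<close> only the term
  \<open>i = 1\<close> survives at 0.\<close>

lemma higher_deriv_WH_op_0:
  assumes h: "h holomorphic_on S" and S: "open S" "0 \<in> S"
  shows "(deriv ^^ n) (WH_op \<alpha> h) 0 = (1 + of_real \<alpha> * of_nat n) * (deriv ^^ Suc n) h 0"
proof -
  note h1 = holomorphic_deriv[OF h S(1)]
  note h2 = holomorphic_deriv[OF h1 S(1)]
  have "(deriv ^^ n) (\<lambda>z. z * deriv (deriv h) z) 0 =
      (\<Sum>i=0..n. of_nat (n choose i) * (deriv ^^ i) (\<lambda>w. w) 0 * (deriv ^^ (n - i)) (deriv (deriv h)) 0)"
    by (rule higher_deriv_mult[OF _ h2 S]) (intro holomorphic_intros)
  also have "\<dots> = (\<Sum>i=0..n. if i = 1 then of_nat n * (deriv ^^ (n - 1)) (deriv (deriv h)) 0 else 0)"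
    by (intro sum.cong) auto
  also have "\<dots> = of_nat n * (deriv ^^ Suc n) h 0"
    by (cases n) (auto simp: funpow_swap1)
  finally have *: "(deriv ^^ n) (\<lambda>z. z * deriv (deriv h) z) 0 = of_nat n * (deriv ^^ Suc n) h 0" .
  have "WH_op \<alpha> h = (\<lambda>z. deriv h z + of_real \<alpha> * (z * deriv (deriv h) z))"
    by (simp add: WH_op_def fun_eq_iff)
  then have "(deriv ^^ n) (WH_op \<alpha> h) 0
     = (deriv ^^ n) (deriv h) 0 + of_real \<alpha> * (deriv ^^ n) (\<lambda>z. z * deriv (deriv h) z) 0"
    using higher_deriv_add[OF h1 _ S, of "\<lambda>z. of_real \<alpha> * (z * deriv (deriv h) z)" n]
          higher_deriv_cmult[of "\<lambda>z. z * deriv (deriv h) z" S 0 n "of_real \<alpha>"] S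
    by (simp add: holomorphic_intros h2)
  then show ?thesis
    by (simp add: * funpow_swap1 algebra_simps)
qed

lemma WH_op_partial_sum:
  assumes h: "h holomorphic_on S" and S: "open S" "0 \<in> S"
  shows "WH_op \<alpha> (partial_sum (Suc n) h) z
    = (\<Sum>k\<le>n. (deriv ^^ k) (WH_op \<alpha> h) 0 / fact k * z ^ k)"
proof -
  define a where "a k = (deriv ^^ k) h 0 / fact k" for k
  have D: "((\<lambda>z. z ^ k) has_field_derivative of_nat k * z ^ (k - 1)) (at z)" for k and z :: complex
    by (auto intro!: derivative_eq_intros)
  have 1: "deriv (partial_sum (Suc n) h) = (\<lambda>z. \<Sum>k=1..Suc n. a k * (of_nat k * z ^ (k - 1)))"
    unfolding partial_sum_def a_def
    by (intro ext DERIV_imp_deriv DERIV_sum DERIV_cmult D)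
  have 2: "deriv (deriv (partial_sum (Suc n) h))
      = (\<lambda>z. \<Sum>k=1..Suc n. a k * (of_nat k * (of_nat (k - 1) * z ^ (k - 1 - 1))))"
    unfolding 1 by (intro ext DERIV_imp_deriv DERIV_sum DERIV_cmult D)
  have "WH_op \<alpha> (partial_sum (Suc n) h) z
     = (\<Sum>k=1..Suc n. a k * (of_nat k * (1 + of_real \<alpha> * of_nat (k - 1))) * z ^ (k - 1))"
    unfolding WH_op_def 2 unfolding 1 sum_distrib_left sum.distrib[symmetric]
  proof (intro sum.cong refl)
    fix k assume "k \<in> {1..Suc n}"
    \<comment> \<open>At \<open>k = 1\<close> truncated subtraction makes the exponent
      \<open>k - 1 - 1\<close> equal 0, but the factor \<open>of_nat (k - 1)\<close>
      vanishes.\<close>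
    have "z * (of_nat (k - 1) * z ^ (k - 1 - 1)) = of_nat (k - 1) * z ^ (k - 1)"
    proof (cases "k \<ge> 2")
      case True
      then obtain j where "k = j + 2"
        using nat_le_iff_add[of 2 k] by (auto simp: add.commute)
      then show ?thesis by simp
    next
      case False
      then have "k - 1 = 0" by simp
      then show ?thesis by simp
    qed
    then show "a k * (of_nat k * z ^ (k - 1))
          + of_real \<alpha> * z * (a k * (of_nat k * (of_nat (k - 1) * z ^ (k - 1 - 1))))
        = a k * (of_nat k * (1 + of_real \<alpha> * of_nat (k - 1))) * z ^ (k - 1)"
      by (simp add: algebra_simps)
  qed
  also have "\<dots> = (\<Sum>k\<le>n. a (Suc k) * (of_nat (Suc k) * (1 + of_real \<alpha> * of_nat k)) * z ^ k)"
    by (subst sum.atLeast_Suc_atMost_Suc_shift[of _ 0, simplified One_nat_def[symmetric]])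
       (simp add: atMost_atLeast0 del: of_nat_Suc)
  also have "\<dots> = (\<Sum>k\<le>n. (deriv ^^ k) (WH_op \<alpha> h) 0 / fact k * z ^ k)"
    unfolding higher_deriv_WH_op_0[OF h S] a_def
    by (intro sum.cong refl) (simp add: field_simps del: of_nat_Suc funpow.simps)
  finally show ?thesis .
qed

section \<open>Transfer to the harmonic partial sums\<close>

text \<open>The comparison of sections applies to \<open>P = WH_op \<alpha> h\<close> and
  \<open>Q = WH_op \<alpha> g\<close>, whose values at 0 are \<open>deriv h 0 = 1\<close> and
  \<open>deriv g 0 = 0\<close>.\<close>

lemma WH_condition_partial_sums:
  fixes n m :: nat
  assumes h: "h holomorphic_on unit_disc" "deriv h 0 = 1"
    and g: "g holomorphic_on unit_disc" "deriv g 0 = 0"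
    and wh: "WH_condition \<alpha> unit_disc h g"
    and nm: "n = 1 \<and> m = 1 \<or> n \<ge> 2 \<and> m \<ge> 2 \<or> n = 2 \<and> m = 1"
  shows "WH_condition \<alpha> (ball 0 (1/2)) (partial_sum (Suc n) h) (partial_sum (Suc m) g)"
proof -
  have "cmod (WH_op \<alpha> (partial_sum (Suc m) g) z)
      < Re (WH_op \<alpha> (partial_sum (Suc n) h) z)" if "z \<in> ball 0 (1/2)" for z
  proof -
    have "cmod (\<Sum>k\<le>m. (deriv ^^ k) (WH_op \<alpha> g) 0 / fact k * z ^ k)
       < Re (\<Sum>k\<le>n. (deriv ^^ k) (WH_op \<alpha> h) 0 / fact k * z ^ k)"
      using that h g wh
      by (intro norm_section_less_Re_section holomorphic_WH_op nm)
         (auto simp: WH_op_def WH_condition_def less_imp_le)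
    then show ?thesis
      using h g by (simp add: WH_op_partial_sum[of _ unit_disc])
  qed
  then show ?thesis
    by (simp add: WH_condition_def WH_op_def)
qed

text \<open>Membership in \<open>WH0\<close> provides the inequality for some representation only.
  By uniqueness any other one agrees with it on the open disc, hence so do the first and second
  derivatives there.\<close>

lemma WH0_canonical_rep:
  assumes f: "f \<in> WH0 \<alpha>" and rep: "canonical_rep f h g"
  shows "deriv g 0 = 0 \<and> WH_condition \<alpha> unit_disc h g"
proof -
  obtain h' g' where rep': "canonical_rep f h' g'" and g'0: "deriv g' 0 = 0"
    and wh: "WH_condition \<alpha> unit_disc h' g'"
    using f by (auto simp: WH0_def)
  have deriv_eq: "deriv u z = deriv v z" if "\<And>x. x \<in> unit_disc \<Longrightarrow> u x = v x" "z \<in> unit_disc"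
    for u v :: "complex \<Rightarrow> complex" and z
    by (rule deriv_cong_ev) (use that in \<open>auto simp: eventually_nhds intro!: exI[of _ unit_disc]\<close>)
  have h: "h z = h' z" and g: "g z = g' z" if "z \<in> unit_disc" for z
    using canonical_rep_unique[OF rep rep' that] by auto
  note dh = deriv_eq[OF h] and dg = deriv_eq[OF g]
  show ?thesis
    using wh g'0 dg deriv_eq[OF dh] deriv_eq[OF dg] dh by (simp add: WH_condition_def)
qed

theorem theorem4p4:
  fixes \<alpha> :: real and f h g :: "complex \<Rightarrow> complex" and p q :: nat
  assumes "\<alpha> \<ge> 0"
    and "f \<in> WH0 \<alpha>"
    and "canonical_rep f h g"
    and "p \<ge> 1" and "q \<ge> 1"
    and "(3 \<le> p \<and> p < q) \<or> (p = q \<and> q \<ge> 2) \<or> (p > q \<and> q \<ge> 3) \<or> (p = 3 \<and> q = 2)"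
  shows "partial_sum_in_WH0 \<alpha> p q h g (1/2)"
proof -
  \<comment> \<open>The case \<open>p = q = 2\<close> becomes \<open>n = m = 1\<close>, the case
    \<open>p = 3\<close>, \<open>q = 2\<close> becomes \<open>n = 2\<close>, \<open>m = 1\<close>,
    and all others give \<open>n \<ge> 2\<close> and \<open>m \<ge> 2\<close>.\<close>
  obtain n m where nm: "p = Suc n" "q = Suc m"
    using assms(4,5) by (metis Suc_le_D One_nat_def)
  show ?thesis
    unfolding partial_sum_in_WH0_def nm
    by (rule WH_condition_partial_sums)
       (use assms nm WH0_canonical_rep[OF assms(2,3)] in \<open>auto simp: canonical_rep_def\<close>)
qed

end
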